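(* Let $k$ be odd and let $\phi$ be a monotone $[k]$-edge-labeling of $K^{(2)}_n$ that minimizes the number of bad triples among all monotone $[k]$-edge-labelings of $K^{(2)}_n$. Then the number of bad triples of $\phi$ is at least $(1-o(1))\frac{4}{(k+1)^2}\binom{n}{3}$, where $o(1)\to0$ as $n\to\infty$ with $k$ fixed.
   Context: $K^{(2)}_n$ is the complete graph on $[n]$ with its natural order. A $[k]$-edge-labeling $\phi$ assigns to each pair $uv$ ($u<v$) a label $\phi(uv)\in\{1,\dots,k\}$; it is monotone if $\phi(uv)\le\phi(vw)$ whenever $u<v<w$. A triple $u<v<w$ is good if $\phi(uv)<\phi(vw)$ and bad otherwise. *)

theory Defs
  imports Complex_Main
begin

text \<open>A [k]-edge-labeling of the complete graph on [n] = {1..n}: each pair u < v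
  in [n] gets a label phi u v in {1..k}. Values outside such pairs are irrelevant.\<close>
definition edge_labeling :: "nat \<Rightarrow> nat \<Rightarrow> (nat \<Rightarrow> nat \<Rightarrow> nat) \<Rightarrow> bool" where
  "edge_labeling n k phi \<longleftrightarrow>
     (\<forall>u v. 1 \<le> u \<and> u < v \<and> v \<le> n \<longrightarrow> phi u v \<in> {1..k})"

definition monotone_labeling :: "nat \<Rightarrow> nat \<Rightarrow> (nat \<Rightarrow> nat \<Rightarrow> nat) \<Rightarrow> bool" where
  "monotone_labeling n k phi \<longleftrightarrow> edge_labeling n k phi \<and>
     (\<forall>u v w. 1 \<le> u \<and> u < v \<and> v < w \<and> w \<le> n \<longrightarrow> phi u v \<le> phi v w)"

definition bad_triples :: "nat \<Rightarrow> (nat \<Rightarrow> nat \<Rightarrow> nat) \<Rightarrow> (nat \<times> nat \<times> nat) set" where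
  "bad_triples n phi = {(u, v, w). 1 \<le> u \<and> u < v \<and> v < w \<and> w \<le> n \<and> \<not> (phi u v < phi v w)}"

definition num_bad :: "nat \<Rightarrow> (nat \<Rightarrow> nat \<Rightarrow> nat) \<Rightarrow> nat" where
  "num_bad n phi = card (bad_triples n phi)"

end

theory Submission
  imports Defs
begin

text \<open>Monotonicity gives every vertex \<open>v\<close> a threshold \<open>c v\<close> between the labels of its left edges and
  the labels of its right edges, so \<open>v\<close> is the middle of exactly \<open>p v * q v\<close> bad triples, where
  \<open>p v\<close> and \<open>q v\<close> count the left and right edges at \<open>v\<close> with label \<open>c v\<close>. For every \<open>r \<ge> 0\<close>,
  writing \<open>t\<^sub>+ = max 0 t\<close>,
  \<open>r\<^sup>2 - 2 * p v * q v \<le> (r - p v)\<^sub>+\<^sup>2 + (r - q v)\<^sub>+\<^sup>2\<close>.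
  Sum this over \<open>v\<close> and group the terms \<open>q v\<close> with \<open>c v = i\<close> together with the terms \<open>p v\<close> with
  \<open>c v = i + 1\<close>. Every edge inside \<open>{v. c v \<in> {i, i + 1}}\<close> is counted at one of its ends, so these
  numbers dominate the scores of a tournament, and by convexity the group contributes at most
  what a transitive tournament does, \<open>\<Sum>j. (r - j)\<^sub>+\<^sup>2 \<le> r\<^sup>3 / 3 + r\<^sup>2\<close>. There are \<open>k + 1\<close> groups;
  take \<open>r = 2 * n / (k + 1)\<close>.\<close>

section \<open>Inequalities for truncated squares and tournament scores\<close>

text \<open>Abel summation: the sum is a combination of the partial sums of \<open>d\<close> with
  coefficients \<open>p j - p (j + 1)\<close> and, at the end, the last \<open>p\<close>, all
  nonnegative.\<close>

lemma sum_mult_antimono_nonneg: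
  fixes p d :: "nat \<Rightarrow> real"
  assumes anti: "\<And>i j. i \<le> j \<Longrightarrow> j < N \<Longrightarrow> p j \<le> p i"
    and nonneg: "\<And>j. j < N \<Longrightarrow> 0 \<le> p j"
    and partial: "\<And>m. m \<le> N \<Longrightarrow> 0 \<le> (\<Sum>j<m. d j)"
  shows "0 \<le> (\<Sum>j<N. p j * d j)"
proof -
  have step: "p m * (\<Sum>j<Suc m. d j) \<le> (\<Sum>j<Suc m. p j * d j)" if "m < N" for m
    using that
  proof (induction m)
    case 0
    then show ?case by simp
  next
    case (Suc m)
    have "p (Suc m) * (\<Sum>j<Suc m. d j) \<le> p m * (\<Sum>j<Suc m. d j)"
      using Suc.prems anti[of m "Suc m"] partial[of "Suc m"] by (intro mult_right_mono) auto
    also have "\<dots> \<le> (\<Sum>j<Suc m. p j * d j)"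
      using Suc by simp
    finally show ?case
      by (simp add: distrib_left)
  qed
  show ?thesis
  proof (cases N)
    case 0
    then show ?thesis by simp
  next
    case (Suc m)
    have "0 \<le> p m * (\<Sum>j<Suc m. d j)"
      using Suc nonneg[of m] partial[of "Suc m"] by (intro mult_nonneg_nonneg) auto
    also have "\<dots> \<le> (\<Sum>j<Suc m. p j * d j)"
      using step[of m] Suc by simp
    finally show ?thesis
      using Suc by simp
  qed
qed

text \<open>The convex function \<open>(max 0 (r - t))\<^sup>2\<close> of \<open>t\<close> lies
  above its tangent at \<open>s\<close>, whose slope is \<open>- 2 * max 0 (r - s)\<close>.\<close>

lemma truncated_square_tangent:
  fixes r s t :: real
  shows "2 * (max 0 (r - s) * (s - t)) \<le> (max 0 (r - t))\<^sup>2 - (max 0 (r - s))\<^sup>2"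
proof (cases "s \<le> r")
  case True
  define a b where "a = r - s" and "b = max 0 (r - t)"
  have "a * (s - t) \<le> a * (b - a)"
    using True by (intro mult_left_mono) (auto simp: a_def b_def)
  moreover have "0 \<le> (b - a)\<^sup>2"
    by simp
  ultimately have "2 * (a * (s - t)) \<le> b\<^sup>2 - a\<^sup>2"
    by (simp add: power2_eq_square algebra_simps)
  with True show ?thesis
    by (simp add: a_def b_def max_def)
next
  case False
  then show ?thesis by (simp add: max_def)
qed

lemma sum_lessThan_real: "(\<Sum>j<m. real j) = real m * (real m - 1) / 2"
  by (induction m) (auto simp: field_simps)

text \<open>The hypothesis on all subsets is Landau's condition on tournament scores.\<close>

lemma landau_sum_truncated_square_le:
  fixes s :: "'a \<Rightarrow> nat" and r :: real
  assumes fin: "finite A"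
    and landau: "\<And>B. B \<subseteq> A \<Longrightarrow> real (card B) * (real (card B) - 1) / 2 \<le> real (sum s B)"
  shows "(\<Sum>x\<in>A. (max 0 (r - real (s x)))\<^sup>2) \<le> (\<Sum>j<card A. (max 0 (r - real j))\<^sup>2)"
proof -
  obtain xs where xs: "set xs = A" "distinct xs"
    using finite_distinct_list[OF fin] by blast
  define ys where "ys = sort_key s xs"
  have ys: "set ys = A" "distinct ys" "sorted (map s ys)"
    using xs by (auto simp: ys_def)
  have len: "length ys = card A"
    using ys distinct_card by fastforce
  have bij: "bij_betw ((!) ys) {..<card A} A"
    using bij_betw_nth[OF ys(2)] ys(1) len by auto
  define \<sigma> where "\<sigma> j = s (ys ! j)" for j
  have mono: "\<sigma> i \<le> \<sigma> j" if "i \<le> j" "j < card A" for i j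
    using ys(3) that len by (auto simp: \<sigma>_def sorted_iff_nth_mono)
  \<comment> \<open>Landau's condition for the \<open>m\<close> vertices of smallest score: their
    scores sum to at least \<open>0 + 1 + ... + (m - 1)\<close>.\<close>
  have partial: "0 \<le> (\<Sum>j<m. real (\<sigma> j) - real j)" if "m \<le> card A" for m
  proof -
    have inj: "inj_on ((!) ys) {..<m}"
      using bij that by (auto simp: bij_betw_def intro: inj_on_subset)
    have "real m * (real m - 1) / 2 \<le> real (sum s ((!) ys ` {..<m}))"
    proof -
      have "(!) ys ` {..<m} \<subseteq> A"
        using ys(1) len that by (auto intro: nth_mem)
      from landau[OF this] show ?thesis
        using card_image[OF inj] by simp
    qed
    also have "\<dots> = (\<Sum>j<m. real (\<sigma> j))"
      by (simp add: sum.reindex[OF inj] \<sigma>_def)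
    finally show ?thesis
      by (simp add: sum_subtractf sum_lessThan_real)
  qed
  \<comment> \<open>The weights are half the negated slopes of the tangents at
    \<open>\<sigma> j\<close>; the tangents are then evaluated at \<open>j\<close>, the transitive
    scores.\<close>
  have "0 \<le> (\<Sum>j<card A. max 0 (r - real (\<sigma> j)) * (real (\<sigma> j) - real j))"
  proof (rule sum_mult_antimono_nonneg)
    fix i j assume "i \<le> j" "j < card A"
    from mono[OF this] show "max 0 (r - real (\<sigma> j)) \<le> max 0 (r - real (\<sigma> i))"
      by auto
  qed (use partial in auto)
  then have "0 \<le> (\<Sum>j<card A. 2 * (max 0 (r - real (\<sigma> j)) * (real (\<sigma> j) - real j)))"
    by (simp flip: sum_distrib_left)
  also have "\<dots> \<le> (\<Sum>j<card A. (max 0 (r - real j))\<^sup>2 - (max 0 (r - real (\<sigma> j)))\<^sup>2)"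
    by (intro sum_mono truncated_square_tangent)
  finally have "(\<Sum>j<card A. (max 0 (r - real (\<sigma> j)))\<^sup>2) \<le> (\<Sum>j<card A. (max 0 (r - real j))\<^sup>2)"
    by (simp add: sum_subtractf)
  moreover have "(\<Sum>x\<in>A. (max 0 (r - real (s x)))\<^sup>2) = (\<Sum>j<card A. (max 0 (r - real (\<sigma> j)))\<^sup>2)"
    unfolding \<sigma>_def by (rule sum.reindex_bij_betw[OF bij, symmetric])
  ultimately show ?thesis
    by simp
qed

text \<open>The term \<open>j = 0\<close> is \<open>r\<^sup>2\<close>; the others are bounded by the
  integral of \<open>(r - t)\<^sup>2\<close> over \<open>[0, r]\<close>. The induction peels off
  that term and shifts \<open>r\<close> to \<open>r - 1\<close>.\<close>

lemma sum_truncated_square_le_cubic: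
  fixes r :: real
  assumes "0 \<le> r"
  shows "(\<Sum>j<N. (max 0 (r - real j))\<^sup>2) \<le> r\<^sup>2 + r ^ 3 / 3"
  using assms
proof (induction N arbitrary: r)
  case 0
  then show ?case by simp
next
  case (Suc N)
  have split: "(\<Sum>j<Suc N. (max 0 (r - real j))\<^sup>2) = r\<^sup>2 + (\<Sum>j<N. (max 0 (r - 1 - real j))\<^sup>2)"
    using Suc.prems by (simp add: sum.lessThan_Suc_shift algebra_simps del: sum.lessThan_Suc)
  show ?case
  proof (cases "1 \<le> r")
    case True
    have "(r - 1)\<^sup>2 + (r - 1) ^ 3 / 3 = r ^ 3 / 3 - r + 2 / 3"
      by (simp add: power2_eq_square power3_eq_cube field_simps)
    with Suc.IH[of "r - 1"] True show ?thesis
      unfolding split by simp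
  next
    case False
    then have "(\<Sum>j<N. (max 0 (r - 1 - real j))\<^sup>2) = 0"
      by (intro sum.neutral) (auto simp: max_def)
    with Suc.prems show ?thesis
      unfolding split by simp
  qed
qed

text \<open>Arcs, reversed arcs and the diagonal cover \<open>B \<times> B\<close>. The sets
  \<open>D x\<close> may leave \<open>B\<close>, which only increases the right-hand side.\<close>

lemma semicomplete_sum_outdegree_ge:
  fixes D :: "'a \<Rightarrow> 'a set"
  assumes fin: "finite B" "\<And>x. x \<in> B \<Longrightarrow> finite (D x)"
    and total: "\<And>x y. x \<in> B \<Longrightarrow> y \<in> B \<Longrightarrow> x \<noteq> y \<Longrightarrow> y \<in> D x \<or> x \<in> D y"
  shows "real (card B) * (real (card B) - 1) / 2 \<le> real (\<Sum>x\<in>B. card (D x))"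
proof -
  let ?E = "Sigma B D"
  have "finite ?E"
    using fin by auto
  have "B \<times> B \<subseteq> ?E \<union> ?E\<inverse> \<union> (\<lambda>x. (x, x)) ` B"
    using total by auto
  then have "card (B \<times> B) \<le> card (?E \<union> ?E\<inverse> \<union> (\<lambda>x. (x, x)) ` B)"
    using \<open>finite ?E\<close> fin(1) by (intro card_mono) auto
  also have "\<dots> \<le> card ?E + card (?E\<inverse>) + card ((\<lambda>x. (x, x)) ` B)"
    by (meson add_le_mono card_Un_le le_refl le_trans)
  also have "\<dots> \<le> 2 * card ?E + card B"
    using card_image_le[OF fin(1)] by (simp add: card_inverse)
  also have "card ?E = (\<Sum>x\<in>B. card (D x))"
    using fin by (intro card_SigmaI) auto
  finally have "card B * card B \<le> 2 * (\<Sum>x\<in>B. card (D x)) + card B"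
    by (simp add: card_cartesian_product)
  then have "real (card B * card B) \<le> real (2 * (\<Sum>x\<in>B. card (D x)) + card B)"
    by (rule of_nat_mono)
  then show ?thesis
    by (simp add: algebra_simps)
qed

text \<open>Decouples a product into one term per factor. For \<open>x, y \<le> r\<close> the two
  sides differ by \<open>(x + y - r)\<^sup>2\<close>; a factor above \<open>r\<close> loses its
  square on the right but can be lowered to \<open>r\<close> in the product.\<close>

lemma square_minus_twice_product_le:
  fixes r x y :: real
  assumes "0 \<le> r" "0 \<le> x" "0 \<le> y"
  shows "r\<^sup>2 - 2 * (x * y) \<le> (max 0 (r - x))\<^sup>2 + (max 0 (r - y))\<^sup>2"
proof -
  have one: "r\<^sup>2 - 2 * (a * b) \<le> (r - a)\<^sup>2" if "r \<le> b" "0 \<le> a" for a b :: real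
  proof -
    have "a * r \<le> a * b" "0 \<le> a * a"
      using that by (auto intro: mult_left_mono)
    moreover have "(r - a)\<^sup>2 = r\<^sup>2 - 2 * (a * r) + a * a"
      by (simp add: power2_eq_square algebra_simps)
    ultimately show ?thesis
      by linarith
  qed
  consider "x \<le> r" "y \<le> r" | "r < x" "r < y" | "r < x" "y \<le> r" | "x \<le> r" "r < y"
    by linarith
  then show ?thesis
  proof cases
    case 1
    have "0 \<le> (x + y - r)\<^sup>2"
      by simp
    with 1 show ?thesis
      by (simp add: max_def power2_eq_square algebra_simps)
  next
    case 2
    have "r * r \<le> x * y" "0 \<le> x * y"
      using 2 assms by (auto intro: mult_mono)
    with 2 show ?thesis
      by (simp add: max_def power2_eq_square)
  next
    case 3
    with one[where a = y and b = x] assms show ?thesis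
      by (simp add: max_def mult.commute)
  next
    case 4
    with one[where a = x and b = y] assms show ?thesis
      by (simp add: max_def)
  qed
qed

section \<open>Vertex thresholds and the count of bad triples\<close>

lemma monotone_labeling_threshold:
  assumes mono: "monotone_labeling n k phi" and "1 \<le> k"
  obtains c where
    "\<And>v. 1 \<le> v \<Longrightarrow> v \<le> n \<Longrightarrow> c v \<in> {1..k}"
    "\<And>u v. 1 \<le> u \<Longrightarrow> u < v \<Longrightarrow> v \<le> n \<Longrightarrow> phi u v \<le> c v"
    "\<And>v w. 1 \<le> v \<Longrightarrow> v < w \<Longrightarrow> w \<le> n \<Longrightarrow> c v \<le> phi v w"
proof
  \<comment> \<open>The largest label of a left edge; the inserted \<open>1\<close> is the value at
    \<open>v = 1\<close>, which has no left edge.\<close>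
  let ?c = "\<lambda>v. Max (insert 1 ((\<lambda>u. phi u v) ` {1..<v}))"
  have range: "phi u v \<in> {1..k}" if "1 \<le> u" "u < v" "v \<le> n" for u v
    using mono that by (auto simp: monotone_labeling_def edge_labeling_def)
  show "?c v \<in> {1..k}" if "1 \<le> v" "v \<le> n" for v
    using range that \<open>1 \<le> k\<close> by (auto intro: Max_ge)
  show "phi u v \<le> ?c v" if "1 \<le> u" "u < v" "v \<le> n" for u v
    using that by (intro Max_ge) auto
  show "?c v \<le> phi v w" if "1 \<le> v" "v < w" "w \<le> n" for v w
    using mono range[of v w] that by (auto simp: monotone_labeling_def)
qed

lemma num_bad_ge_cubic:
  fixes r :: real
  assumes mono: "monotone_labeling n k phi" and "1 \<le> k" and "0 \<le> r"
  shows "r\<^sup>2 * real n - (real k + 1) * (r\<^sup>2 + r ^ 3 / 3) \<le> 2 * real (num_bad n phi)"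
proof -
  obtain c where c_range: "\<And>v. 1 \<le> v \<Longrightarrow> v \<le> n \<Longrightarrow> c v \<in> {1..k}"
    and c_ge: "\<And>u v. 1 \<le> u \<Longrightarrow> u < v \<Longrightarrow> v \<le> n \<Longrightarrow> phi u v \<le> c v"
    and c_le: "\<And>v w. 1 \<le> v \<Longrightarrow> v < w \<Longrightarrow> w \<le> n \<Longrightarrow> c v \<le> phi v w"
    using monotone_labeling_threshold[OF mono \<open>1 \<le> k\<close>] by metis
  define P where "P v = {u. 1 \<le> u \<and> u < v \<and> phi u v = c v}" for v
  define Q where "Q v = {w. v < w \<and> w \<le> n \<and> phi v w = c v}" for v
  have fin [simp]: "finite (P v)" "finite (Q v)" for v
    by (rule finite_subset[of _ "{..v}"], auto simp: P_def)
       (rule finite_subset[of _ "{..n}"], auto simp: Q_def)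
  define g where "g m = (max 0 (r - real m))\<^sup>2" for m :: nat

  \<comment> \<open>A triple with middle \<open>v\<close> and both labels equal to
    \<open>c v\<close> is bad.\<close>
  have "(\<Sum>v\<in>{1..n}. card (P v) * card (Q v)) = card (SIGMA v:{1..n}. P v \<times> Q v)"
    by (simp add: card_cartesian_product)
  also have "\<dots> = card ((\<lambda>(v, u, w). (u, v, w)) ` (SIGMA v:{1..n}. P v \<times> Q v))"
    by (intro card_image[symmetric]) (auto simp: inj_on_def)
  also have "\<dots> \<le> num_bad n phi"
    unfolding num_bad_def
  proof (rule card_mono)
    show "finite (bad_triples n phi)"
      by (rule finite_subset[of _ "{..n} \<times> {..n} \<times> {..n}"]) (auto simp: bad_triples_def)
  qed (auto simp: bad_triples_def P_def Q_def)
  finally have bad: "(\<Sum>v\<in>{1..n}. card (P v) * card (Q v)) \<le> num_bad n phi" .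

  have group: "(\<Sum>v | v \<in> {1..n} \<and> c v = i. g (card (Q v))) +
      (\<Sum>v | v \<in> {1..n} \<and> c v = Suc i. g (card (P v))) \<le> r\<^sup>2 + r ^ 3 / 3" for i
  proof -
    let ?L = "{v. v \<in> {1..n} \<and> c v = i}" and ?R = "{v. v \<in> {1..n} \<and> c v = Suc i}"
    define D where "D v = (if c v = i then Q v else P v)" for v
    have finD: "finite (D v)" for v
      by (simp add: D_def)
    \<comment> \<open>Since \<open>c x \<le> phi x y \<le> c y\<close>, the label is
      \<open>i\<close> or \<open>Suc i\<close>. Label \<open>i\<close> forces
      \<open>c x = i\<close>, so \<open>y \<in> Q x\<close>; label \<open>Suc i\<close> forces
      \<open>c y = Suc i\<close>, so \<open>x \<in> P y\<close>.\<close>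
    have edge: "y \<in> D x \<or> x \<in> D y" if "x \<in> ?L \<union> ?R" "y \<in> ?L \<union> ?R" "x < y" for x y
      using that c_le[of x y] c_ge[of x y] by (auto simp: D_def P_def Q_def)
    have "(\<Sum>v\<in>?L \<union> ?R. g (card (D v))) \<le> (\<Sum>j<card (?L \<union> ?R). g j)"
      unfolding g_def
    proof (rule landau_sum_truncated_square_le)
      fix B assume B: "B \<subseteq> ?L \<union> ?R"
      then have "finite B"
        by (rule finite_subset) auto
      then show "real (card B) * (real (card B) - 1) / 2 \<le> real (\<Sum>v\<in>B. card (D v))"
      proof (rule semicomplete_sum_outdegree_ge)
        fix x y assume "x \<in> B" "y \<in> B" "x \<noteq> y"
        then show "y \<in> D x \<or> x \<in> D y"
          using edge[of x y] edge[of y x] B by (meson linorder_neqE_nat subsetD)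
      qed (rule finD)
    qed auto
    also have "\<dots> \<le> r\<^sup>2 + r ^ 3 / 3"
      unfolding g_def by (rule sum_truncated_square_le_cubic[OF \<open>0 \<le> r\<close>])
    also have "(\<Sum>v\<in>?L \<union> ?R. g (card (D v))) =
        (\<Sum>v\<in>?L. g (card (D v))) + (\<Sum>v\<in>?R. g (card (D v)))"
      by (intro sum.union_disjoint) auto
    finally show ?thesis
      by (simp add: D_def)
  qed

  \<comment> \<open>Thresholds lie in \<open>{1..k}\<close>, so group \<open>0\<close> has only
    \<open>P\<close> terms and group \<open>k\<close> only \<open>Q\<close> terms.\<close>
  have sumQ: "(\<Sum>v\<in>{1..n}. g (card (Q v))) =
      (\<Sum>i\<in>{..k}. \<Sum>v | v \<in> {1..n} \<and> c v = i. g (card (Q v)))"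
    using c_range by (intro sum.group[symmetric]) auto
  have sumP: "(\<Sum>v\<in>{1..n}. g (card (P v))) =
      (\<Sum>i\<in>{..k}. \<Sum>v | v \<in> {1..n} \<and> c v = Suc i. g (card (P v)))"
  proof -
    have "(\<Sum>v\<in>{1..n}. g (card (P v))) =
        (\<Sum>i\<in>Suc ` {..k}. \<Sum>v | v \<in> {1..n} \<and> c v = i. g (card (P v)))"
    proof (intro sum.group[symmetric])
      show "c ` {1..n} \<subseteq> Suc ` {..k}"
        using c_range by (fastforce simp: image_Suc_atMost)
    qed auto
    then show ?thesis
      by (simp add: sum.reindex)
  qed

  have "r\<^sup>2 * real n - 2 * real (\<Sum>v\<in>{1..n}. card (P v) * card (Q v)) =
      (\<Sum>v\<in>{1..n}. r\<^sup>2 - 2 * (real (card (P v)) * real (card (Q v))))"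
    by (simp add: sum_subtractf sum_distrib_left)
  also have "\<dots> \<le> (\<Sum>v\<in>{1..n}. g (card (P v)) + g (card (Q v)))"
    unfolding g_def using \<open>0 \<le> r\<close> by (intro sum_mono square_minus_twice_product_le) auto
  also have "\<dots> = (\<Sum>i\<in>{..k}. (\<Sum>v | v \<in> {1..n} \<and> c v = i. g (card (Q v))) +
      (\<Sum>v | v \<in> {1..n} \<and> c v = Suc i. g (card (P v))))"
    by (simp only: sum.distrib sumP sumQ add.commute)
  also have "\<dots> \<le> (\<Sum>i\<in>{..k}. r\<^sup>2 + r ^ 3 / 3)"
    by (intro sum_mono group)
  also have "\<dots> = (real k + 1) * (r\<^sup>2 + r ^ 3 / 3)"
    by (simp add: add.commute)
  finally show ?thesis
    using of_nat_mono[OF bad, where 'a = real] by linarith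
qed

section \<open>Optimising \<open>r\<close> and passing to the limit\<close>

lemma num_bad_ge:
  assumes "monotone_labeling n k phi" "1 \<le> k"
  shows "4 / (real k + 1)\<^sup>2 * (real n ^ 3 / 6 - (real k + 1) * (real n)\<^sup>2 / 2)
    \<le> real (num_bad n phi)"
proof -
  define K where "K = real k + 1"
  have "K > 0"
    by (simp add: K_def)
  \<comment> \<open>This maximizes the leading part \<open>r\<^sup>2 * n - K * r ^ 3 / 3\<close>
    over \<open>r \<ge> 0\<close>.\<close>
  define r where "r = 2 * real n / K"
  have "r\<^sup>2 * real n - K * (r\<^sup>2 + r ^ 3 / 3) \<le> 2 * real (num_bad n phi)"
    using num_bad_ge_cubic[OF assms, of r] by (simp add: r_def K_def)
  moreover have "r\<^sup>2 * real n - K * (r\<^sup>2 + r ^ 3 / 3) =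
      2 * (4 / K\<^sup>2 * (real n ^ 3 / 6 - K * (real n)\<^sup>2 / 2))"
    using \<open>K > 0\<close> by (simp add: r_def power2_eq_square power3_eq_cube field_simps)
  ultimately show ?thesis
    unfolding K_def[symmetric] by linarith
qed

lemma choose_three_le: "real (n choose 3) \<le> real n ^ 3 / 6"
proof -
  have "real (n choose 3) * fact 3 \<le> real n ^ 3"
    using binomial_fact_pow[of n 3] by (metis of_nat_fact of_nat_le_iff of_nat_mult of_nat_power)
  then show ?thesis
    by (simp add: fact_numeral)
qed

theorem theorem4p11:
  fixes k :: nat
  assumes "odd k"
  shows "\<forall>\<epsilon>>0. \<exists>N. \<forall>n\<ge>N. \<forall>phi.
           monotone_labeling n k phi \<and>
           (\<forall>psi. monotone_labeling n k psi \<longrightarrow> num_bad n phi \<le> num_bad n psi) \<longrightarrow>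
           real (num_bad n phi) \<ge> (1 - \<epsilon>) * (4 / (real k + 1)^2) * real (n choose 3)"
proof (intro allI impI)
  fix \<epsilon> :: real
  assume "\<epsilon> > 0"
  have "1 \<le> k"
    using assms by (cases k) auto
  define K where "K = real k + 1"
  have "K > 0"
    by (simp add: K_def)
  have "(1 - \<epsilon>) * (4 / K\<^sup>2) * real (n choose 3) \<le> real (num_bad n phi)"
    \<comment> \<open>From \<open>3 * K \<le> \<epsilon> * n\<close> the error
      \<open>K * n\<^sup>2 / 2\<close> is at most \<open>\<epsilon> * n ^ 3 / 6\<close>.\<close>
    if n: "n \<ge> nat \<lceil>3 * K / \<epsilon>\<rceil>" and phi: "monotone_labeling n k phi" for n phi
  proof (cases "\<epsilon> < 1")
    case True
    have "3 * K / \<epsilon> \<le> real n"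
      using n by linarith
    then have "3 * K \<le> \<epsilon> * real n"
      using \<open>\<epsilon> > 0\<close> by (simp add: field_simps)
    then have "3 * K * (real n)\<^sup>2 \<le> \<epsilon> * real n * (real n)\<^sup>2"
      by (intro mult_right_mono) auto
    moreover have "\<epsilon> * real n * (real n)\<^sup>2 = \<epsilon> * real n ^ 3"
      by (simp add: power2_eq_square power3_eq_cube)
    ultimately have lower: "(1 - \<epsilon>) * (real n ^ 3 / 6) \<le> real n ^ 3 / 6 - K * (real n)\<^sup>2 / 2"
      by (simp add: left_diff_distrib)
    have "(1 - \<epsilon>) * real (n choose 3) \<le> (1 - \<epsilon>) * (real n ^ 3 / 6)"
      using True by (intro mult_left_mono choose_three_le) auto
    also note lower
    finally have "4 / K\<^sup>2 * ((1 - \<epsilon>) * real (n choose 3)) \<le>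
        4 / K\<^sup>2 * (real n ^ 3 / 6 - K * (real n)\<^sup>2 / 2)"
      by (intro mult_left_mono) auto
    also have "\<dots> \<le> real (num_bad n phi)"
      using num_bad_ge[OF phi \<open>1 \<le> k\<close>] by (simp add: K_def)
    also have "4 / K\<^sup>2 * ((1 - \<epsilon>) * real (n choose 3)) = (1 - \<epsilon>) * (4 / K\<^sup>2) * real (n choose 3)"
      by simp
    finally show ?thesis .
  next
    case False
    \<comment> \<open>For \<open>\<epsilon> \<ge> 1\<close> the claimed bound is
      nonpositive.\<close>
    then have "(1 - \<epsilon>) * (4 / K\<^sup>2) * real (n choose 3) \<le> 0"
      by (intro mult_nonpos_nonneg) (auto simp: divide_nonpos_nonneg)
    then show ?thesis
      by (meson of_nat_0_le_iff order_trans)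
  qed
  then show "\<exists>N. \<forall>n\<ge>N. \<forall>phi.
           monotone_labeling n k phi \<and>
           (\<forall>psi. monotone_labeling n k psi \<longrightarrow> num_bad n phi \<le> num_bad n psi) \<longrightarrow>
           real (num_bad n phi) \<ge> (1 - \<epsilon>) * (4 / (real k + 1)^2) * real (n choose 3)"
    unfolding K_def by blast
qed

end
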